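(* Let $(X,\mu,m)$ be a connected weighted graph which admits a compatible intrinsic metric $\rho$, let $o\in X$ be a fixed vertex and $\rho_1=1\vee\rho(\cdot,o)$. Let $u:X\to Y$ be a harmonic map into an Hadamard space $(Y,d)$. If there are $p\in(1,\infty)$ and $y\in Y$ such that $$d(u(\cdot),y)\in L^p(X,m\rho_1^{-2}),$$ then $u$ is bounded. Moreover, if $m\rho_1^{-2}(X)=\sum_{x\in X}m(x)\rho_1(x)^{-2}=\infty$ or $y$ is in the image of $u$, then $u$ is constant.
   Context: Weighted graph: $X$ is a countable discrete set, $m:X\to(0,\infty)$ is extended additively to a measure on all subsets of $X$, and $\mu:X\times X\to[0,\infty)$, $(x,y)\mapsto\mu_{xy}$, is symmetric, zero on the diagonal, and satisfies $\sum_{y\in X}\mu_{xy}<\infty$ for all $x\in X$ (local finiteness is not assumed). Write $x\sim y$ if $\mu_{xy}>0$. The graph is connected if any two vertices $x,y$ are joined by a path $x=x_0\sim x_1\sim\dots\sim x_n=y$. Compatible intrinsic metric: a pseudo metric is a symmetric map $\rho:X\times X\to[0,\infty)$ with zero diagonal satisfying the triangle inequality. It is intrinsic if $\sum_{y\in X}\mu_{xy}\rho^2(x,y)\le m(x)$ for all $x\in X$. Its jump size is $s=\sup\{\rho(x,y)\mid x\sim y\}$. The weighted vertex degree is $\mathrm{Deg}(x)=\frac1{m(x)}\sum_{y\in X}\mu_{xy}$. A pseudo metric is compatible if $s<\infty$ and $\mathrm{Deg}$ is bounded on each ball $B_r=\{x\mid\rho(x,o)\le r\}$, $r\ge0$.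 Notation: $a\vee b=\max(a,b)$; $g\in L^p(X,m\rho_1^{-2})$ means $\sum_{x\in X}|g(x)|^p\rho_1(x)^{-2}m(x)<\infty$. Harmonic maps: an Hadamard space $(Y,d)$ is a complete geodesic $\mathrm{CAT}(0)$ space. Let $P^1(Y)$ be the probability measures on $Y$ with finite first moment. For $\nu\in P^1(Y)$ the barycenter $b(\nu)\in Y$ is the unique minimizer of $z\mapsto\int_Y\big(d^2(z,y)-d^2(w,y)\big)\nu(dy)$, which does not depend on the choice of $w\in Y$. Put $P_x(y)=\mu_{xy}/\sum_{z\in X}\mu_{xz}$ and let $F(X,Y)$ be the set of maps $u:X\to Y$ with $\sum_{y\in X}d(u(y),y_0)P_x(y)<\infty$ for all $x\in X$, $y_0\in Y$. A map $u:X\to Y$ is harmonic if $u\in F(X,Y)$ and $u(x)=b(u_*P_x)$ for every $x\in X$, where $u_*P_x$ is the push forward of $P_x$ under $u$. The map $u$ is bounded if its image is a bounded subset of $Y$. *)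

theory Defs
  imports "HOL-Analysis.Analysis"
begin

section \<open>Weighted graphs and compatible intrinsic metrics\<close>

locale weighted_graph =
  fixes m :: "'v::countable \<Rightarrow> real" and \<mu> :: "'v \<Rightarrow> 'v \<Rightarrow> real"
  assumes m_pos: "m x > 0"
    and \<mu>_nonneg: "\<mu> x y \<ge> 0"
    and \<mu>_sym: "\<mu> x y = \<mu> y x"
    and \<mu>_diag: "\<mu> x x = 0"
    and \<mu>_summable: "\<mu> x summable_on UNIV"

definition adjacent :: "('v \<Rightarrow> 'v \<Rightarrow> real) \<Rightarrow> 'v \<Rightarrow> 'v \<Rightarrow> bool" where
  "adjacent \<mu> x y \<longleftrightarrow> \<mu> x y > 0"

definition connected_graph :: "('v \<Rightarrow> 'v \<Rightarrow> real) \<Rightarrow> bool" where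
  "connected_graph \<mu> \<longleftrightarrow> (\<forall>x y. (adjacent \<mu>)\<^sup>*\<^sup>* x y)"

definition weighted_degree :: "('v \<Rightarrow> real) \<Rightarrow> ('v \<Rightarrow> 'v \<Rightarrow> real) \<Rightarrow> 'v \<Rightarrow> real" where
  "weighted_degree m \<mu> x = (1 / m x) * (\<Sum>\<^sub>\<infinity>y. \<mu> x y)"

definition pseudo_metric :: "('v \<Rightarrow> 'v \<Rightarrow> real) \<Rightarrow> bool" where
  "pseudo_metric \<rho> \<longleftrightarrow>
    (\<forall>x y. \<rho> x y \<ge> 0) \<and> (\<forall>x. \<rho> x x = 0) \<and> (\<forall>x y. \<rho> x y = \<rho> y x) \<and>
    (\<forall>x y z. \<rho> x z \<le> \<rho> x y + \<rho> y z)"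

text \<open>The sum is required to converge explicitly, as \<^const>\<open>infsum\<close> is 0 for divergent sums.\<close>

definition intrinsic ::
  "('v \<Rightarrow> real) \<Rightarrow> ('v \<Rightarrow> 'v \<Rightarrow> real) \<Rightarrow> ('v \<Rightarrow> 'v \<Rightarrow> real) \<Rightarrow> bool" where
  "intrinsic m \<mu> \<rho> \<longleftrightarrow>
    (\<forall>x. (\<lambda>y. \<mu> x y * (\<rho> x y)\<^sup>2) summable_on UNIV \<and>
         (\<Sum>\<^sub>\<infinity>y. \<mu> x y * (\<rho> x y)\<^sup>2) \<le> m x)"

definition jump_size :: "('v \<Rightarrow> 'v \<Rightarrow> real) \<Rightarrow> ('v \<Rightarrow> 'v \<Rightarrow> real) \<Rightarrow> ennreal" where
  "jump_size \<mu> \<rho> = Sup {ennreal (\<rho> x y) | x y. adjacent \<mu> x y}"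

text \<open>The distance balls are centred at the fixed vertex \<open>x\<^sub>0\<close> (written \<open>o\<close> on paper).\<close>

definition compatible ::
  "('v \<Rightarrow> real) \<Rightarrow> ('v \<Rightarrow> 'v \<Rightarrow> real) \<Rightarrow> 'v \<Rightarrow> ('v \<Rightarrow> 'v \<Rightarrow> real) \<Rightarrow> bool" where
  "compatible m \<mu> x\<^sub>0 \<rho> \<longleftrightarrow>
    jump_size \<mu> \<rho> < \<infinity> \<and>
    (\<forall>r\<ge>0. bounded (weighted_degree m \<mu> ` {x. \<rho> x x\<^sub>0 \<le> r}))"

definition rho1 :: "('v \<Rightarrow> 'v \<Rightarrow> real) \<Rightarrow> 'v \<Rightarrow> 'v \<Rightarrow> real" where
  "rho1 \<rho> x\<^sub>0 x = max 1 (\<rho> x x\<^sub>0)"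

text \<open>Membership in \<open>L\<^sup>p(X, w)\<close> for a measure given by point masses \<open>w x \<ge> 0\<close>.\<close>

definition in_Lp :: "real \<Rightarrow> ('v \<Rightarrow> real) \<Rightarrow> ('v \<Rightarrow> real) \<Rightarrow> bool" where
  "in_Lp p w g \<longleftrightarrow> (\<lambda>x. \<bar>g x\<bar> powr p * w x) summable_on UNIV"


section \<open>Hadamard spaces and barycenters\<close>

text \<open>Geodesics are parametrized on the unit interval proportionally to arc length.\<close>

definition geodesic :: "(real \<Rightarrow> 'y::metric_space) \<Rightarrow> 'y \<Rightarrow> 'y \<Rightarrow> bool" where
  "geodesic \<gamma> p q \<longleftrightarrow>
    \<gamma> 0 = p \<and> \<gamma> 1 = q \<and>
    (\<forall>s\<in>{0..1}. \<forall>t\<in>{0..1}. dist (\<gamma> s) (\<gamma> t) = \<bar>s - t\<bar> * dist p q)"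

definition comparison_triangle ::
  "'y::metric_space \<Rightarrow> 'y \<Rightarrow> 'y \<Rightarrow> real^2 \<Rightarrow> real^2 \<Rightarrow> real^2 \<Rightarrow> bool" where
  "comparison_triangle p q r p' q' r' \<longleftrightarrow>
    dist p' q' = dist p q \<and> dist q' r' = dist q r \<and> dist r' p' = dist r p"

text \<open>
  In \<open>cat0\<close>, each side of a geodesic triangle is paired with the corresponding side of a
  Euclidean comparison triangle; because of the proportional parametrization, \<open>\<sigma>' s\<close> is the
  comparison point of \<open>\<sigma> s\<close>.
\<close>

class hadamard_space = complete_space +
  assumes geodesic_ex: "\<exists>\<gamma>. geodesic \<gamma> p q"
    and cat0: "\<lbrakk>geodesic \<alpha> p q; geodesic \<beta> q r; geodesic \<gamma> r p;
      comparison_triangle p q r p' q' r';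
      (\<sigma>, \<sigma>') \<in> {(\<alpha>, linepath p' q'), (\<beta>, linepath q' r'), (\<gamma>, linepath r' p')};
      (\<tau>, \<tau>') \<in> {(\<alpha>, linepath p' q'), (\<beta>, linepath q' r'), (\<gamma>, linepath r' p')};
      s \<in> {0..1}; t \<in> {0..1}\<rbrakk>
      \<Longrightarrow> dist (\<sigma> s) (\<tau> t) \<le> dist (\<sigma>' s) (\<tau>' t)"

text \<open>
  Meaningful for Borel probability measures with finite first moment: then the integrals exist
  and the minimizer exists, is unique and does not depend on \<open>w\<close>.
\<close>

definition barycenter :: "'y::metric_space measure \<Rightarrow> 'y" where
  "barycenter \<nu> =
    (THE b. \<forall>w. is_arg_min (\<lambda>z. LINT y|\<nu>. ((dist z y)\<^sup>2 - (dist w y)\<^sup>2)) (\<lambda>_. True) b)"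


section \<open>Harmonic maps\<close>

definition transition :: "('v \<Rightarrow> 'v \<Rightarrow> real) \<Rightarrow> 'v \<Rightarrow> 'v \<Rightarrow> real" where
  "transition \<mu> x y = \<mu> x y / (\<Sum>\<^sub>\<infinity>z. \<mu> x z)"

definition transition_measure :: "('v \<Rightarrow> 'v \<Rightarrow> real) \<Rightarrow> 'v \<Rightarrow> 'v measure" where
  "transition_measure \<mu> x = density (count_space UNIV) (\<lambda>y. ennreal (transition \<mu> x y))"

definition F_maps :: "('v \<Rightarrow> 'v \<Rightarrow> real) \<Rightarrow> ('v \<Rightarrow> 'y::metric_space) set" where
  "F_maps \<mu> = {u. \<forall>x y\<^sub>0. (\<lambda>y. dist (u y) y\<^sub>0 * transition \<mu> x y) summable_on UNIV}"

definition harmonic_map :: "('v \<Rightarrow> 'v \<Rightarrow> real) \<Rightarrow> ('v \<Rightarrow> 'y::metric_space) \<Rightarrow> bool" where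
  "harmonic_map \<mu> u \<longleftrightarrow>
    u \<in> F_maps \<mu> \<and> (\<forall>x. u x = barycenter (distr (transition_measure \<mu> x) borel u))"

end

theory Submission
  imports Defs "HOL-Probability.Probability_Measure"
begin

text \<open>
  Everything reduces to one scalar function: \<open>f x = dist (u x) y\<close> is constant.  Once this is known,
  \<open>u\<close> takes values in a sphere about \<open>y\<close> and is bounded; the radius is zero if \<open>y\<close> is a value of
  \<open>u\<close>, and also if the measure \<open>m \<rho>\<^sub>1\<^sup>-\<^sup>2\<close> is infinite, since no other constant is in \<open>L\<^sup>p\<close> then.

  Harmonicity of \<open>u\<close> enters only through the subharmonicity of \<open>f\<close>, that is, through Jensen's
  inequality \<open>dist (b \<nu>) q \<le> \<integral> dist q y \<nu>(dy)\<close> for the barycenter (\<open>Jensen_dist\<close>).  Moving from the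
  minimizer \<open>b = b \<nu>\<close> towards \<open>q\<close> along a geodesic cannot decrease the energy, and the CAT(0) inequality
  turns this into the variance inequality \<open>dist b q\<^sup>2 \<le> \<integral> (dist q y\<^sup>2 - dist b y\<^sup>2) \<nu>(dy)\<close>.
  With \<open>dist b y \<ge> \<bar>dist b q - dist q y\<bar>\<close> the squares \<open>dist q y\<^sup>2\<close> cancel and Jensen's inequality
  remains.

  That a nonnegative subharmonic \<open>f\<close> in \<open>L\<^sup>p(X, m \<rho>\<^sub>1\<^sup>-\<^sup>2)\<close> is constant is a Caccioppoli argument.  Test
  the inequality \<open>\<Sum>\<^sub>y \<mu>\<^sub>x\<^sub>y (f y - f x) \<ge> 0\<close> with \<open>f\<^sup>p\<^sup>-\<^sup>1 \<eta>\<^sup>2\<close>, where \<open>\<eta>\<close> is a cutoff function that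
  is 1 on the ball of radius \<open>R\<close>, vanishes outside that of radius \<open>2R\<close> and has slope \<open>1/R\<close>.
  Symmetrizing the double sum and applying the elementary inequality \<open>pointwise_Caccioppoli\<close> on each
  edge, the sum of \<open>\<mu>\<^sub>x\<^sub>y (f x - f y) (f x\<^sup>p\<^sup>-\<^sup>1 - f y\<^sup>p\<^sup>-\<^sup>1) (\<eta> x\<^sup>2 + \<eta> y\<^sup>2)\<close> is bounded by a
  multiple of the sum of \<open>\<mu>\<^sub>x\<^sub>y f x\<^sup>p (\<eta> x - \<eta> y)\<^sup>2\<close>.  Because the metric is intrinsic with finite jump
  size \<open>s\<close>, the latter is at most the mass of \<open>f\<^sup>p\<close> at distance \<open>R - s\<close> to \<open>2R + s\<close> divided by
  \<open>R\<^sup>2\<close>, hence a multiple of a tail of the convergent sum of \<open>f\<^sup>p m \<rho>\<^sub>1\<^sup>-\<^sup>2\<close>, and tends to zero as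
  \<open>R \<rightarrow> \<infinity>\<close>.  So \<open>f\<close> agrees at the ends of
  every edge, and is constant by connectedness.  The bound for the weighted degree on balls
  makes all double sums absolutely convergent, which the symmetrization requires.
\<close>

section \<open>The CAT(0) inequality\<close>

text \<open>
  Two sides of the triangle fix \<open>p'\<close> and \<open>q'\<close> on the first axis; the law of cosines gives the foot
  \<open>h\<close> of the altitude from \<open>r'\<close>, and the triangle inequalities say exactly that the squared altitude
  \<open>b\<^sup>2 - h\<^sup>2\<close> is nonnegative.
\<close>
lemma comparison_triangle_exists:
  fixes p q r :: "'y::metric_space"
  shows "\<exists>p' q' r'. comparison_triangle p q r p' q' r'"
proof -
  define a b c where "a = dist p q" and "b = dist p r" and "c = dist q r"
  have tri: "a \<ge> 0" "b \<ge> 0" "c \<ge> 0" "a \<le> b + c" "b \<le> a + c" "c \<le> a + b"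
    unfolding a_def b_def c_def
    using dist_triangle[of p q r] dist_triangle[of p r q] dist_triangle[of q r p]
    by (simp_all add: dist_commute[of r q] dist_commute[of q p])
  define h where "h = (if a = 0 then b else (a\<^sup>2 + b\<^sup>2 - c\<^sup>2) / (2 * a))"
  have h2: "2 * a * h = a\<^sup>2 + b\<^sup>2 - c\<^sup>2"
    using tri by (auto simp: h_def)
  have hb: "h\<^sup>2 \<le> b\<^sup>2"
  proof (cases "a = 0")
    case False
    have "2 * a * (b - h) = (c - (a - b)) * (c + (a - b))" "2 * a * (b + h) = (a + b - c) * (a + b + c)"
      using h2 by (simp_all add: power2_eq_square algebra_simps)
    then have "2 * a * (b - h) \<ge> 0" "2 * a * (b + h) \<ge> 0"
      using tri by (simp_all add: mult_nonneg_nonneg)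
    then have "\<bar>h\<bar> \<le> b"
      using False tri by (simp add: zero_le_mult_iff)
    then show ?thesis by (simp add: abs_le_square_iff[symmetric] tri)
  qed (simp add: h_def)
  define k where "k = sqrt (b\<^sup>2 - h\<^sup>2)"
  have k2: "k\<^sup>2 = b\<^sup>2 - h\<^sup>2" using hb by (simp add: k_def)
  have d: "dist (vector [x, y] :: real^2) (vector [z, w]) = sqrt ((x - z)\<^sup>2 + (y - w)\<^sup>2)" for x y z w :: real
    by (simp add: dist_vec_def L2_set_def UNIV_2 vector_2 dist_real_def)
  have "comparison_triangle p q r (vector [0, 0]) (vector [a, 0]) (vector [h, k])"
  proof -
    have "sqrt ((a - h)\<^sup>2 + k\<^sup>2) = c" "sqrt (h\<^sup>2 + k\<^sup>2) = b"
      using tri h2 by (simp_all add: k2 power2_diff)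
    then show ?thesis
      using tri
      by (simp add: comparison_triangle_def d flip: a_def b_def c_def)
         (simp add: b_def dist_commute)
  qed
  then show ?thesis by blast
qed

lemma dist_linepath_sq:
  fixes p q r :: "'a::real_inner"
  shows "(dist (linepath p q t) r)\<^sup>2
    = (1 - t) * (dist p r)\<^sup>2 + t * (dist q r)\<^sup>2 - t * (1 - t) * (dist p q)\<^sup>2"
proof -
  have "(norm ((1 - t) *\<^sub>R v + t *\<^sub>R w))\<^sup>2
    = (1 - t) * (norm v)\<^sup>2 + t * (norm w)\<^sup>2 - t * (1 - t) * (norm (v - w))\<^sup>2" for v w :: 'a
    unfolding power2_norm_eq_inner
    by (simp add: inner_add_left inner_add_right inner_diff_left inner_diff_right
        inner_commute[of w v] algebra_simps)
  from this[of "p - r" "q - r"] show ?thesis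
    by (simp add: dist_norm linepath_def algebra_simps)
qed

text \<open>
  Compare a point on one side of a geodesic triangle with the opposite vertex; the right-hand side is
  the squared Euclidean distance in the comparison triangle, by Stewart's theorem.
\<close>
lemma CAT0_inequality:
  fixes p q r :: "'y::hadamard_space"
  assumes "geodesic \<gamma> p q" and t: "t \<in> {0..1}"
  shows "(dist (\<gamma> t) r)\<^sup>2
    \<le> (1 - t) * (dist p r)\<^sup>2 + t * (dist q r)\<^sup>2 - t * (1 - t) * (dist p q)\<^sup>2"
proof -
  obtain \<beta> \<delta> where g: "geodesic \<beta> q r" "geodesic \<delta> r p"
    using geodesic_ex by blast
  obtain p' q' r' where c: "comparison_triangle p q r p' q' r'"
    using comparison_triangle_exists by blast
  have "dist (\<gamma> t) (\<beta> 1) \<le> dist (linepath p' q' t) (linepath q' r' 1)"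
    by (rule cat0[OF assms(1) g c, where \<sigma>=\<gamma> and \<tau>=\<beta>]) (use t in auto)
  moreover have "\<beta> 1 = r" using g by (simp add: geodesic_def)
  ultimately have "dist (\<gamma> t) r \<le> dist (linepath p' q' t) r'"
    by (simp add: linepath_def)
  then have "(dist (\<gamma> t) r)\<^sup>2 \<le> (dist (linepath p' q' t) r')\<^sup>2"
    by (simp add: power_mono)
  also have "\<dots> = (1 - t) * (dist p r)\<^sup>2 + t * (dist q r)\<^sup>2 - t * (1 - t) * (dist p q)\<^sup>2"
    using c unfolding dist_linepath_sq comparison_triangle_def by (simp add: dist_commute)
  finally show ?thesis .
qed

section \<open>Barycenters and Jensen's inequality\<close>

text \<open>
  The next two bounds are linear in \<open>dist w y\<close>, so that differences of squared distances
  are integrable, with explicit estimates, as soon as \<open>dist w\<close> is.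
\<close>
lemma abs_dist_sq_diff_le:
  fixes w y z :: "'a::metric_space"
  shows "\<bar>(dist z y)\<^sup>2 - (dist w y)\<^sup>2\<bar> \<le> (dist z w)\<^sup>2 + 2 * dist z w * dist w y"
proof -
  have 1: "\<bar>dist z y - dist w y\<bar> \<le> dist z w"
    using dist_triangle[of z y w] dist_triangle[of w y z] by (auto simp: dist_commute)
  have "\<bar>(dist z y)\<^sup>2 - (dist w y)\<^sup>2\<bar> = \<bar>(dist z y - dist w y) * (dist z y + dist w y)\<bar>"
    by (simp add: power2_eq_square algebra_simps)
  also have "\<dots> = \<bar>dist z y - dist w y\<bar> * (dist z y + dist w y)"
    by (simp add: abs_mult)
  also have "\<dots> \<le> dist z w * (dist z w + 2 * dist w y)"
    by (rule mult_mono) (use 1 dist_triangle[of z y w] in auto)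
  finally show ?thesis by (simp add: power2_eq_square algebra_simps)
qed

lemma dist_sq_diff_ge:
  fixes w y z :: "'a::metric_space"
  shows "(dist z w)\<^sup>2 - 2 * dist z w * dist w y \<le> (dist z y)\<^sup>2 - (dist w y)\<^sup>2"
proof -
  have "\<bar>dist z w - dist w y\<bar> \<le> dist z y"
    using dist_triangle[of z w y] dist_triangle[of w y z] by (auto simp: dist_commute)
  then have "(dist z w - dist w y)\<^sup>2 \<le> (dist z y)\<^sup>2"
    by (simp add: abs_le_square_iff[symmetric])
  then show ?thesis by (simp add: power2_diff)
qed

locale first_moment = prob_space \<nu> for \<nu> :: "'y::hadamard_space measure" +
  assumes sets_borel [measurable_cong, simp]: "sets \<nu> = sets borel"
    and moment: "integrable \<nu> (dist w)"
begin

text \<open>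
  The energy of \<open>z\<close> relative to the base point \<open>w\<close>, of which the barycenter is the minimizer.
  Subtracting \<open>(dist w y)\<^sup>2\<close> keeps it finite without a second moment.
\<close>
definition rel_energy :: "'y \<Rightarrow> 'y \<Rightarrow> real" where
  "rel_energy w z = (LINT y|\<nu>. ((dist z y)\<^sup>2 - (dist w y)\<^sup>2))"

lemma borel_measurable_dist [measurable]: "dist w \<in> borel_measurable \<nu>"
  by (rule borel_measurable_integrable[OF moment])

lemma integrable_affine_dist [simp, intro]:
  "integrable \<nu> (\<lambda>y. c + k * dist w y)" "integrable \<nu> (\<lambda>y. c - k * dist w y)"
  using moment by simp_all

lemma integrable_sq_diff: "integrable \<nu> (\<lambda>y. (dist z y)\<^sup>2 - (dist w y)\<^sup>2)"
proof (rule Bochner_Integration.integrable_bound)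
  show "integrable \<nu> (\<lambda>y. (dist z w)\<^sup>2 + 2 * dist z w * dist w y)"
    by simp
  show "AE y in \<nu>. norm ((dist z y)\<^sup>2 - (dist w y)\<^sup>2) \<le> norm ((dist z w)\<^sup>2 + 2 * dist z w * dist w y)"
    using abs_dist_sq_diff_le[of z _ w] by (auto intro!: AE_I2)
qed measurable

text \<open>A change of the base point shifts the energy by a constant, so minimizers do not depend on it.\<close>
lemma rel_energy_change_base: "rel_energy w z = rel_energy v z - rel_energy v w"
  unfolding rel_energy_def
  by (subst Bochner_Integration.integral_diff[symmetric]) (auto intro: integrable_sq_diff)

lemma rel_energy_abs_le: "\<bar>rel_energy w z\<bar> \<le> (dist z w)\<^sup>2 + 2 * dist z w * (LINT y|\<nu>. dist w y)"
proof -
  have "\<bar>rel_energy w z\<bar> \<le> (LINT y|\<nu>. \<bar>(dist z y)\<^sup>2 - (dist w y)\<^sup>2\<bar>)"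
    unfolding rel_energy_def by (rule integral_abs_bound)
  also have "\<dots> \<le> (LINT y|\<nu>. (dist z w)\<^sup>2 + 2 * dist z w * dist w y)"
    by (rule integral_mono) (auto intro!: integrable_abs integrable_sq_diff abs_dist_sq_diff_le)
  also have "\<dots> = (dist z w)\<^sup>2 + 2 * dist z w * (LINT y|\<nu>. dist w y)"
    using moment by (simp add: prob_space)
  finally show ?thesis .
qed

lemma rel_energy_ge: "(dist z w)\<^sup>2 - 2 * dist z w * (LINT y|\<nu>. dist w y) \<le> rel_energy w z"
proof -
  have "(dist z w)\<^sup>2 - 2 * dist z w * (LINT y|\<nu>. dist w y) = (LINT y|\<nu>. (dist z w)\<^sup>2 - 2 * dist z w * dist w y)"
    using moment by (simp add: prob_space)
  also have "\<dots> \<le> rel_energy w z"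
    unfolding rel_energy_def by (rule integral_mono) (auto intro: integrable_sq_diff dist_sq_diff_ge)
  finally show ?thesis .
qed

lemma rel_energy_uniformly_convex:
  assumes "geodesic \<gamma> p q" and t: "t \<in> {0..1}"
  shows "rel_energy w (\<gamma> t) \<le> (1 - t) * rel_energy w p + t * rel_energy w q - t * (1 - t) * (dist p q)\<^sup>2"
proof -
  have "rel_energy w (\<gamma> t) \<le> (LINT y|\<nu>. (1 - t) * ((dist p y)\<^sup>2 - (dist w y)\<^sup>2)
      + t * ((dist q y)\<^sup>2 - (dist w y)\<^sup>2) - t * (1 - t) * (dist p q)\<^sup>2)"
    unfolding rel_energy_def
  proof (rule integral_mono)
    show "(dist (\<gamma> t) y)\<^sup>2 - (dist w y)\<^sup>2
      \<le> (1 - t) * ((dist p y)\<^sup>2 - (dist w y)\<^sup>2) + t * ((dist q y)\<^sup>2 - (dist w y)\<^sup>2)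
        - t * (1 - t) * (dist p q)\<^sup>2" for y
      using CAT0_inequality[OF assms, of y] by (simp add: algebra_simps)
  qed (auto intro!: integrable_sq_diff Bochner_Integration.integrable_diff Bochner_Integration.integrable_add integrable_mult_right)
  also have "\<dots> = (1 - t) * rel_energy w p + t * rel_energy w q - t * (1 - t) * (dist p q)\<^sup>2"
    unfolding rel_energy_def
    by (subst Bochner_Integration.integral_diff Bochner_Integration.integral_add;
        auto intro!: integrable_sq_diff Bochner_Integration.integrable_diff Bochner_Integration.integrable_add integrable_mult_right
         simp: prob_space)+
  finally show ?thesis .
qed

text \<open>
  Uniform convexity at the midpoint of two almost minimal points forces them to be close.  This gives
  both the convergence of minimizing sequences and the uniqueness of the minimizer.
\<close>
lemma dist_sq_le_of_almost_min:
  assumes "\<And>z. l \<le> rel_energy w z" and "rel_energy w p \<le> l + e" "rel_energy w q \<le> l + e"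
  shows "(dist p q)\<^sup>2 \<le> 4 * e"
proof -
  obtain \<gamma> where "geodesic \<gamma> p q" using geodesic_ex by blast
  from rel_energy_uniformly_convex[OF this, of "1/2" w] assms(1)[of "\<gamma> (1/2)"] assms(2,3)
  show ?thesis by (simp add: field_simps)
qed

text \<open>
  A minimizing sequence is Cauchy by almost minimality; the energy is bounded below by completing the
  square in \<open>rel_energy_ge\<close>, and continuous by \<open>rel_energy_abs_le\<close> based at the limit point.
\<close>
lemma minimizer_exists: "\<exists>b. \<forall>z. rel_energy w b \<le> rel_energy w z"
proof -
  define M where "M = (LINT y|\<nu>. dist w y)"
  have "- M\<^sup>2 \<le> rel_energy w z" for z
    using rel_energy_ge[of z w] zero_le_power2[of "dist z w - M"]
    by (simp add: M_def power2_diff)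
  then have bdd: "bdd_below (range (rel_energy w))" by (intro bdd_belowI[of _ "- M\<^sup>2"]) auto
  define l where "l = (INF z. rel_energy w z)"
  have l: "l \<le> rel_energy w z" for z unfolding l_def by (rule cINF_lower[OF bdd]) simp
  have "\<exists>z. rel_energy w z < l + inverse (real (Suc n))" for n
    using cINF_less_iff[OF _ bdd, of "l + inverse (real (Suc n))"] by (auto simp: l_def)
  then obtain Z where Z: "\<And>n. rel_energy w (Z n) < l + inverse (real (Suc n))" by metis
  have close: "(dist (Z i) (Z j))\<^sup>2 \<le> 4 * inverse (real (Suc N))" if "i \<ge> N" "j \<ge> N" for i j N
  proof (rule dist_sq_le_of_almost_min[OF l])
    have mono: "inverse (real (Suc i)) \<le> inverse (real (Suc N))" if "i \<ge> N" for i
      using that by (simp add: le_imp_inverse_le)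
    show "rel_energy w (Z i) \<le> l + inverse (real (Suc N))" "rel_energy w (Z j) \<le> l + inverse (real (Suc N))"
      using Z[of i] Z[of j] mono[OF that(1)] mono[OF that(2)] by linarith+
  qed
  have "Cauchy Z"
  proof (rule metric_CauchyI)
    fix e :: real assume "e > 0"
    then obtain N where N: "inverse (real (Suc N)) < e\<^sup>2 / 4"
      using reals_Archimedean[of "e\<^sup>2 / 4"] by auto
    have "dist (Z i) (Z j) < e" if "i \<ge> N" "j \<ge> N" for i j
    proof -
      have "(dist (Z i) (Z j))\<^sup>2 < e\<^sup>2" using close[OF that] N by linarith
      then show ?thesis using \<open>e > 0\<close> by (simp add: power2_less_imp_less)
    qed
    then show "\<exists>M. \<forall>i\<ge>M. \<forall>j\<ge>M. dist (Z i) (Z j) < e" by blast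
  qed
  then obtain b where b: "Z \<longlonglongrightarrow> b" by (auto simp: Cauchy_convergent_iff convergent_def)
  have "rel_energy w b \<le> l"
  proof (rule LIMSEQ_le_const)
    define D where "D n = dist (Z n) b" for n
    have D: "D \<longlonglongrightarrow> 0" unfolding D_def using b tendsto_dist_iff by blast
    show "(\<lambda>n. l + inverse (real (Suc n)) + ((D n)\<^sup>2 + 2 * D n * (LINT y|\<nu>. dist b y))) \<longlonglongrightarrow> l"
    proof -
      have "(\<lambda>n. l + inverse (real (Suc n)) + ((D n)\<^sup>2 + 2 * D n * (LINT y|\<nu>. dist b y)))
        \<longlonglongrightarrow> l + 0 + (0\<^sup>2 + 2 * 0 * (LINT y|\<nu>. dist b y))"
        by (intro tendsto_intros D LIMSEQ_inverse_real_of_nat)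
      then show ?thesis by simp
    qed
    show "\<exists>N. \<forall>n\<ge>N. rel_energy w b \<le> l + inverse (real (Suc n)) + ((D n)\<^sup>2 + 2 * D n * (LINT y|\<nu>. dist b y))"
    proof (intro exI[of _ 0] allI impI)
      fix n
      show "rel_energy w b \<le> l + inverse (real (Suc n)) + ((D n)\<^sup>2 + 2 * D n * (LINT y|\<nu>. dist b y))"
        using rel_energy_abs_le[of b "Z n"] rel_energy_change_base[of b "Z n" w] Z[of n] by (simp add: D_def)
    qed
  qed
  with l show ?thesis by (meson order_trans)
qed

lemma barycenter_minimizes: "rel_energy w (barycenter \<nu>) \<le> rel_energy w z"
proof -
  have eq: "barycenter \<nu> = (THE b. \<forall>w z. rel_energy w b \<le> rel_energy w z)"
    unfolding barycenter_def is_arg_min_def rel_energy_def by (simp add: not_less)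
  obtain b where b: "\<And>z. rel_energy w b \<le> rel_energy w z" using minimizer_exists by blast
  have b': "\<forall>v z. rel_energy v b \<le> rel_energy v z"
    using b rel_energy_change_base[of _ _ w] by (metis diff_right_mono)
  have "\<forall>w z. rel_energy w (barycenter \<nu>) \<le> rel_energy w z"
    unfolding eq
  proof (rule theI[where a = b])
    show "\<forall>v z. rel_energy v b \<le> rel_energy v z" by (fact b')
    fix c assume c: "\<forall>v z. rel_energy v c \<le> rel_energy v z"
    have "(dist c b)\<^sup>2 \<le> 4 * 0"
      by (rule dist_sq_le_of_almost_min[where w=w and l="rel_energy w b"]) (use b c in auto)
    then show "c = b" by simp
  qed
  then show ?thesis by blast
qed

text \<open>
  Along a geodesic from the barycenter \<open>b\<close> to \<open>q\<close> the energy relative to \<open>b\<close> is nonnegative, while uniform convexity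
  bounds it by \<open>t\<close> times \<open>rel_energy b q - (1 - t) * (dist b q)\<^sup>2\<close>; divide by \<open>t\<close> and let \<open>t \<rightarrow> 0\<close>.
\<close>
lemma variance_inequality: "(dist (barycenter \<nu>) q)\<^sup>2 \<le> rel_energy (barycenter \<nu>) q"
proof -
  define b where "b = barycenter \<nu>"
  obtain \<gamma> where g: "geodesic \<gamma> b q" using geodesic_ex by blast
  have 0: "rel_energy b b = 0" by (simp add: rel_energy_def)
  have *: "(1 - t) * (dist b q)\<^sup>2 \<le> rel_energy b q" if t: "0 < t" "t \<le> 1" for t
  proof -
    have "0 \<le> rel_energy b (\<gamma> t)" using barycenter_minimizes[of b "\<gamma> t"] 0 by (simp add: b_def)
    then have "0 \<le> t * (rel_energy b q - (1 - t) * (dist b q)\<^sup>2)"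
      using rel_energy_uniformly_convex[OF g, of t b] t 0 by (simp add: algebra_simps)
    then show ?thesis using t by (simp add: zero_le_mult_iff)
  qed
  have "((\<lambda>t. (1 - t) * (dist b q)\<^sup>2) \<longlongrightarrow> (1 - 0) * (dist b q)\<^sup>2) (at_right 0)"
    by (intro tendsto_intros)
  moreover have "eventually (\<lambda>t::real. (1 - t) * (dist b q)\<^sup>2 \<le> rel_energy b q) (at_right 0)"
    using * eventually_at_right_less[of 0] by (auto simp: eventually_at_right_field intro: exI[of _ 1])
  ultimately have "(1 - 0) * (dist b q)\<^sup>2 \<le> rel_energy b q"
    by (rule tendsto_upperbound) simp
  then show ?thesis by (simp add: b_def)
qed

text \<open>
  For \<open>D = dist b q\<close> and \<open>R\<close> the mean distance to \<open>q\<close>, the variance inequality bounds \<open>D\<^sup>2\<close> from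
  above by \<open>- rel_energy q b\<close>, and the reverse triangle inequality bounds this by \<open>2 * D * R - D\<^sup>2\<close>.
\<close>
lemma Jensen_dist: "dist (barycenter \<nu>) q \<le> (LINT y|\<nu>. dist q y)"
proof -
  define b D R where "b = barycenter \<nu>" and "D = dist b q" and "R = (LINT y|\<nu>. dist q y)"
  have R: "R \<ge> 0" unfolding R_def by (rule Bochner_Integration.integral_nonneg) simp
  have "D\<^sup>2 \<le> rel_energy b q" using variance_inequality[of q] by (simp add: D_def b_def)
  also have "rel_energy b q = - rel_energy q b" using rel_energy_change_base[of b q q] by (simp add: rel_energy_def)
  also have "\<dots> \<le> 2 * D * R - D\<^sup>2" using rel_energy_ge[of b q] by (simp add: D_def R_def)
  finally have "D * D \<le> D * R" by (simp add: power2_eq_square)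
  then have "D \<le> R" using R by (cases "D > 0") (auto simp: D_def)
  then show ?thesis by (simp add: b_def D_def R_def)
qed

end

section \<open>Distance functions of harmonic maps\<close>

text \<open>Multiplying out the total weight avoids dividing by zero at an isolated vertex.\<close>
definition (in weighted_graph) subharmonic :: "('v \<Rightarrow> real) \<Rightarrow> bool" where
  "subharmonic f \<longleftrightarrow> (\<forall>x. (\<lambda>y. \<mu> x y * f y) summable_on UNIV \<and>
     f x * (\<Sum>\<^sub>\<infinity>y. \<mu> x y) \<le> (\<Sum>\<^sub>\<infinity>y. \<mu> x y * f y))"

text \<open>
  Jensen's inequality for the push forward of the transition measure, with integrals over the discrete
  measure rewritten as infinite sums.  Positivity of the total weight makes this a probability measure.
\<close>
lemma (in weighted_graph) harmonic_dist_le_average: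
  fixes u :: "'v \<Rightarrow> 'y::hadamard_space"
  assumes "harmonic_map \<mu> u" and pos: "(\<Sum>\<^sub>\<infinity>y. \<mu> x y) > 0"
  shows "(\<lambda>y. \<mu> x y * dist (u y) q) summable_on UNIV"
    and "dist (u x) q * (\<Sum>\<^sub>\<infinity>y. \<mu> x y) \<le> (\<Sum>\<^sub>\<infinity>y. \<mu> x y * dist (u y) q)"
proof -
  define W where "W = (\<Sum>\<^sub>\<infinity>y. \<mu> x y)"
  define P where "P = transition \<mu> x"
  define N where "N = transition_measure \<mu> x"
  have W: "W > 0" using pos by (simp add: W_def)
  have P: "P y = \<mu> x y / W" for y by (simp add: P_def transition_def W_def)
  have P0: "P y \<ge> 0" for y using W \<mu>_nonneg by (simp add: P)
  have lift: "integrable (count_space UNIV) h" "(LINT y|count_space UNIV. h y) = (\<Sum>\<^sub>\<infinity>y. h y)"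
    if "h summable_on UNIV" for h :: "'v \<Rightarrow> real"
  proof -
    have a: "Infinite_Set_Sum.abs_summable_on h UNIV"
      using that summable_on_iff_abs_summable_on_real[of h UNIV] abs_summable_equivalent[of h UNIV]
      by blast
    then show "integrable (count_space UNIV) h" by (simp add: abs_summable_on_def)
    show "(LINT y|count_space UNIV. h y) = (\<Sum>\<^sub>\<infinity>y. h y)"
      using infsetsum_infsum[OF a] by (simp add: infsetsum_def)
  qed
  have Ps: "P summable_on UNIV" "(\<Sum>\<^sub>\<infinity>y. P y) = 1"
    using W summable_on_cmult_left[OF \<mu>_summable[of x], of "1 / W"] infsum_cmult_left[OF \<mu>_summable[of x], of "1 / W"]
    by (auto simp: P[abs_def] W_def[symmetric])
  have Pd: "(\<lambda>y. P y * dist z (u y)) summable_on UNIV" for z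
  proof -
    have "u \<in> F_maps \<mu>" using assms(1) by (simp add: harmonic_map_def)
    then show ?thesis by (simp add: F_maps_def P_def dist_commute mult.commute)
  qed
  have N: "sets N = UNIV" "space N = UNIV" by (simp_all add: N_def transition_measure_def)
  have N_eq: "N = density (count_space UNIV) (\<lambda>y. ennreal (P y))"
    by (simp add: N_def transition_measure_def P_def)
  have [measurable]: "u \<in> measurable N borel"
    by (auto simp: measurable_def N)
  interpret N: prob_space N
  proof (rule prob_spaceI)
    have "emeasure N (space N) = (\<integral>\<^sup>+y. ennreal (P y) \<partial>count_space UNIV)"
      by (simp add: N_eq emeasure_density)
    also have "\<dots> = ennreal (LINT y|count_space UNIV. P y)"
      by (rule nn_integral_eq_integral) (use lift Ps P0 in auto)
    finally show "emeasure N (space N) = 1" by (simp add: lift Ps)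
  qed
  have [measurable]: "dist w \<in> borel_measurable borel" for w :: 'y
    by (intro borel_measurable_continuous_onI continuous_intros)
  interpret push: prob_space "distr N borel u"
    by (rule N.prob_space_distr) measurable
  interpret \<nu>: first_moment "distr N borel u"
  proof
    show "integrable (distr N borel u) (dist w)" for w
      using lift(1)[OF Pd[of w]] P0
      by (subst integrable_distr_eq) (auto simp: N_eq integrable_density)
  qed simp
  have "dist (u x) q \<le> (LINT y|distr N borel u. dist q y)"
    using \<nu>.Jensen_dist[of q] assms(1) by (simp add: harmonic_map_def N_def)
  also have "\<dots> = (LINT y|N. dist q (u y))"
    by (rule integral_distr) measurable
  also have "\<dots> = (\<Sum>\<^sub>\<infinity>y. P y * dist q (u y))"
    unfolding N_eq using P0 lift(2)[OF Pd[of q]] by (subst integral_density) auto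
  finally have J: "dist (u x) q \<le> (\<Sum>\<^sub>\<infinity>y. P y * dist q (u y))" .
  have eq: "\<mu> x y * dist (u y) q = W * (P y * dist q (u y))" for y
    using W by (simp add: P dist_commute)
  show "(\<lambda>y. \<mu> x y * dist (u y) q) summable_on UNIV"
    unfolding eq by (rule summable_on_cmult_right[OF Pd])
  show "dist (u x) q * (\<Sum>\<^sub>\<infinity>y. \<mu> x y) \<le> (\<Sum>\<^sub>\<infinity>y. \<mu> x y * dist (u y) q)"
    unfolding eq infsum_cmult_right[OF Pd] W_def[symmetric]
    using J W by (simp add: mult.commute)
qed

lemma (in weighted_graph) subharmonic_dist_harmonic:
  fixes u :: "'v \<Rightarrow> 'y::hadamard_space"
  assumes "harmonic_map \<mu> u"
  shows "subharmonic (\<lambda>x. dist (u x) q)"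
  unfolding subharmonic_def
proof
  fix x
  show "(\<lambda>y. \<mu> x y * dist (u y) q) summable_on UNIV \<and>
    dist (u x) q * (\<Sum>\<^sub>\<infinity>y. \<mu> x y) \<le> (\<Sum>\<^sub>\<infinity>y. \<mu> x y * dist (u y) q)"
  proof (cases "(\<Sum>\<^sub>\<infinity>y. \<mu> x y) > 0")
    case True
    then show ?thesis using harmonic_dist_le_average[OF assms] by blast
  next
    case False
    (* At an isolated vertex the transition measure is null and every point minimizes
       its energy; but there both sides of the inequality vanish. *)
    then have "\<mu> x y = 0" for y
      using nonneg_infsum_le_0D[OF _ \<mu>_summable[of x], of y] \<mu>_nonneg by auto
    then show ?thesis by simp
  qed
qed

section \<open>A pointwise Caccioppoli inequality\<close>

text \<open>
  For \<open>q \<ge> 1\<close> the bound is \<open>t powr q \<le> t\<close>; for \<open>q < 1\<close> it is the tangent of the concave function at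
  \<open>t = 1\<close>, obtained from the weighted arithmetic-geometric mean inequality.  The factor
  \<open>min 1 q\<close> is the only place where the exponent enters the constants below.
\<close>
lemma powr_le_chord:
  fixes t q :: real
  assumes "0 \<le> t" "t \<le> 1" "0 < q"
  shows "t powr q \<le> 1 - min 1 q * (1 - t)"
proof (cases "t = 0 \<or> q \<ge> 1")
  case True
  then show ?thesis
    using assms powr_mono'[of 1 q t] by (auto simp: min_def)
next
  case False
  then show ?thesis
    using Youngs_inequality_0[of q "1 - q" t 1] assms by (simp add: algebra_simps)
qed

text \<open>Homogeneous form of the chord bound: a lower estimate of \<open>a powr q - b powr q\<close> by \<open>a - b\<close>.\<close>
lemma powr_diff_ge:
  fixes a b q :: real
  assumes "0 \<le> b" "b \<le> a" "0 < q"
  shows "min 1 q * (a - b) * a powr q \<le> (a powr q - b powr q) * a"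
proof (cases "a = 0")
  case False
  then have a: "a > 0" using assms by simp
  have "b powr q = (a * (b / a)) powr q" using a by simp
  also have "\<dots> = a powr q * (b / a) powr q"
    using a assms by (subst powr_mult) auto
  finally have "a powr q - b powr q = a powr q * (1 - (b / a) powr q)"
    by (simp add: algebra_simps)
  moreover have "min 1 q * (1 - b / a) \<le> 1 - (b / a) powr q"
    using powr_le_chord[of "b / a" q] a assms by simp
  ultimately have "a powr q * (min 1 q * (1 - b / a)) * a \<le> (a powr q - b powr q) * a"
    using a by (simp add: mult_left_mono)
  moreover have "a powr q * (min 1 q * (1 - b / a)) * a = min 1 q * (a - b) * a powr q"
    using a by (simp add: right_diff_distrib left_diff_distrib)
  ultimately show ?thesis by simp
qed (use assms in auto)

text \<open>
  The discrete product rule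
  \<open>A \<alpha>\<^sup>2 - B \<beta>\<^sup>2 = (A - B) (\<alpha>\<^sup>2 + \<beta>\<^sup>2) / 2 + (A + B) / 2 * (\<alpha> + \<beta>) (\<alpha> - \<beta>)\<close> with \<open>A = a powr q\<close>,
  \<open>B = b powr q\<close> splits the right-hand side into an energy term and a cross term.  Young's inequality
  absorbs the cross term: half of the energy survives, and the error is a multiple of
  \<open>a powr (q + 1) * (\<alpha> - \<beta>)\<^sup>2\<close>.  The absorption works uniformly in \<open>a \<ge> b \<ge> 0\<close>, \<open>b = 0\<close> included,
  because by \<open>powr_diff_ge\<close> the energy dominates \<open>w = (a - b)\<^sup>2 * A / a\<close> up to the factor \<open>min 1 q\<close>, and
  \<open>((a - b) * A)\<^sup>2 = w * (A * a)\<close>.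
\<close>
lemma pointwise_Caccioppoli:
  fixes a b \<alpha> \<beta> q :: real
  assumes "0 \<le> a" "0 \<le> b" "0 < q"
  shows "(a - b) * (a powr q - b powr q) * (\<alpha>\<^sup>2 + \<beta>\<^sup>2) / 4
      - 2 / min 1 q * (a powr (q + 1) + b powr (q + 1)) * (\<alpha> - \<beta>)\<^sup>2
    \<le> (a - b) * (a powr q * \<alpha>\<^sup>2 - b powr q * \<beta>\<^sup>2)"
proof -
  have main: "(a - b) * (a powr q - b powr q) * (\<alpha>\<^sup>2 + \<beta>\<^sup>2) / 4
      - 2 / min 1 q * a powr (q + 1) * (\<alpha> - \<beta>)\<^sup>2
    \<le> (a - b) * (a powr q * \<alpha>\<^sup>2 - b powr q * \<beta>\<^sup>2)"
    if ab: "0 \<le> b" "b \<le> a" for a b \<alpha> \<beta> :: real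
  proof (cases "a = b")
    case True
    then show ?thesis using assms by simp
  next
    case False
    then have a: "a > 0" using ab by simp
    define k A B w where "k = min 1 q" and "A = a powr q" and "B = b powr q" and "w = (a - b)\<^sup>2 * A / a"
    have k: "k > 0" using assms by (simp add: k_def)
    have A: "0 < A" "0 \<le> B" "B \<le> A" "a powr (q + 1) = A * a"
      using ab a assms by (simp_all add: A_def B_def powr_mono2 powr_add)
    have w0: "w \<ge> 0" using a A by (simp add: w_def)
    have "(a - b) * (k * (a - b) * A) \<le> (a - b) * ((A - B) * a)"
      unfolding k_def A_def B_def by (rule mult_left_mono[OF powr_diff_ge]) (use ab assms in auto)
    then have kw: "k * w \<le> (a - b) * (A - B)"
      using a by (simp add: w_def field_simps power2_eq_square)
    (* Young's inequality with weights k/8 and 2/k, whose product is 1/4: sum and difference of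
       the two sides are perfect squares. *)
    have "k / 8 * w * (\<alpha> + \<beta>)\<^sup>2 + 2 / k * (A * a) * (\<alpha> - \<beta>)\<^sup>2 + (a - b) * A * (\<alpha> + \<beta>) * (\<alpha> - \<beta>)
      = A / (8 * k * a) * (k * (a - b) * (\<alpha> + \<beta>) + 4 * a * (\<alpha> - \<beta>))\<^sup>2"
      using a k by (simp add: w_def field_simps power2_eq_square)
    moreover have "k / 8 * w * (\<alpha> + \<beta>)\<^sup>2 + 2 / k * (A * a) * (\<alpha> - \<beta>)\<^sup>2 - (a - b) * A * (\<alpha> + \<beta>) * (\<alpha> - \<beta>)
      = A / (8 * k * a) * (k * (a - b) * (\<alpha> + \<beta>) - 4 * a * (\<alpha> - \<beta>))\<^sup>2"
      using a k by (simp add: w_def field_simps power2_eq_square)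
    ultimately have young: "\<bar>(a - b) * A * ((\<alpha> + \<beta>) * (\<alpha> - \<beta>))\<bar>
        \<le> k / 8 * w * (\<alpha> + \<beta>)\<^sup>2 + 2 / k * (A * a) * (\<alpha> - \<beta>)\<^sup>2" (is "_ \<le> ?Y")
    proof -
      assume 1: "?Y + (a - b) * A * (\<alpha> + \<beta>) * (\<alpha> - \<beta>) = A / (8 * k * a) * (k * (a - b) * (\<alpha> + \<beta>) + 4 * a * (\<alpha> - \<beta>))\<^sup>2"
        and 2: "?Y - (a - b) * A * (\<alpha> + \<beta>) * (\<alpha> - \<beta>) = A / (8 * k * a) * (k * (a - b) * (\<alpha> + \<beta>) - 4 * a * (\<alpha> - \<beta>))\<^sup>2"
      have "A / (8 * k * a) * z\<^sup>2 \<ge> 0" for z using a k A by simp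
      then show ?thesis using 1 2 by (smt (verit) mult.assoc)
    qed
    have "k / 8 * w * (\<alpha> + \<beta>)\<^sup>2 \<le> k / 8 * w * (2 * (\<alpha>\<^sup>2 + \<beta>\<^sup>2))"
      by (rule mult_left_mono)
         (use k w0 zero_le_power2[of "\<alpha> - \<beta>"] in \<open>auto simp: power2_diff power2_sum\<close>)
    moreover have "k * w * ((\<alpha>\<^sup>2 + \<beta>\<^sup>2) / 4) \<le> (a - b) * (A - B) * ((\<alpha>\<^sup>2 + \<beta>\<^sup>2) / 4)"
      by (rule mult_right_mono[OF kw]) simp
    moreover have "k / 8 * w * (2 * (\<alpha>\<^sup>2 + \<beta>\<^sup>2)) = k * w * ((\<alpha>\<^sup>2 + \<beta>\<^sup>2) / 4)"
      by simp
    ultimately have Y: "?Y \<le> (a - b) * (A - B) * ((\<alpha>\<^sup>2 + \<beta>\<^sup>2) / 4) + 2 / k * (A * a) * (\<alpha> - \<beta>)\<^sup>2"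
      by linarith
    have "\<bar>(a - b) * ((A + B) / 2) * ((\<alpha> + \<beta>) * (\<alpha> - \<beta>))\<bar> \<le> \<bar>(a - b) * A * ((\<alpha> + \<beta>) * (\<alpha> - \<beta>))\<bar>"
      unfolding abs_mult using A by (intro mult_right_mono mult_left_mono) auto
    moreover have "(a - b) * (A * \<alpha>\<^sup>2 - B * \<beta>\<^sup>2)
      = (a - b) * (A - B) * ((\<alpha>\<^sup>2 + \<beta>\<^sup>2) / 2) + (a - b) * ((A + B) / 2) * ((\<alpha> + \<beta>) * (\<alpha> - \<beta>))"
      by (simp add: field_simps power2_eq_square)
    ultimately show ?thesis
      using young Y unfolding A(4) A_def[symmetric] B_def[symmetric] k_def[symmetric] by (simp add: field_simps)
  qed
  have nn: "0 \<le> 2 / min 1 q * c powr (q + 1) * (\<alpha> - \<beta>)\<^sup>2" for c using assms by simp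
  show ?thesis
  proof (cases "b \<le> a")
    case True
    from main[OF assms(2) this, of \<alpha> \<beta>] nn[of b] show ?thesis by (simp add: distrib_left distrib_right)
  next
    case False
    have "(b - a) * (b powr q - a powr q) * (\<beta>\<^sup>2 + \<alpha>\<^sup>2) = (a - b) * (a powr q - b powr q) * (\<alpha>\<^sup>2 + \<beta>\<^sup>2)"
      "(b - a) * (b powr q * \<beta>\<^sup>2 - a powr q * \<alpha>\<^sup>2) = (a - b) * (a powr q * \<alpha>\<^sup>2 - b powr q * \<beta>\<^sup>2)"
      by (simp_all add: algebra_simps)
    with main[OF assms(1), of b \<beta> \<alpha>] False nn[of a] show ?thesis
      by (simp add: distrib_left distrib_right power2_commute[of \<beta> \<alpha>])
  qed
qed

section \<open>Sums over pairs and tails\<close>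

lemma summable_on_diff:
  fixes f g :: "'a \<Rightarrow> real"
  assumes "f summable_on A" "g summable_on A"
  shows "(\<lambda>x. f x - g x) summable_on A"
    and "infsum (\<lambda>x. f x - g x) A = infsum f A - infsum g A"
  using summable_on_add[of f A "\<lambda>x. - g x"] infsum_add[of f A "\<lambda>x. - g x"] assms
  by (simp_all add: summable_on_uminus infsum_uminus)

text \<open>Fubini for nonnegative weights: iterated bounds give summability over pairs.\<close>
lemma weighted_pair_sum:
  fixes w :: "'a \<Rightarrow> 'b \<Rightarrow> real" and g c :: "'a \<Rightarrow> real"
  assumes "\<And>x. w x summable_on UNIV" "\<And>x y. 0 \<le> w x y" "\<And>x. 0 \<le> g x"
    and "\<And>x. g x * (\<Sum>\<^sub>\<infinity>y. w x y) \<le> c x" "c summable_on UNIV"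
  shows "(\<lambda>(x, y). g x * w x y) summable_on UNIV"
    and "(\<Sum>\<^sub>\<infinity>(x, y). g x * w x y) \<le> (\<Sum>\<^sub>\<infinity>x. c x)"
proof -
  have s: "(\<lambda>x. g x * (\<Sum>\<^sub>\<infinity>y. w x y)) summable_on UNIV"
    by (rule summable_on_comparison_test[OF assms(5,4)]) (simp add: assms infsum_nonneg)
  have "(\<lambda>(x, y). g x * w x y) summable_on (UNIV \<times> UNIV)"
    by (rule summable_on_SigmaI[OF _ s])
       (use assms in \<open>auto intro!: has_sum_cmult_right has_sum_infsum\<close>)
  then show sp: "(\<lambda>(x, y). g x * w x y) summable_on UNIV" by simp
  have "(\<Sum>\<^sub>\<infinity>(x, y). g x * w x y) = (\<Sum>\<^sub>\<infinity>x. \<Sum>\<^sub>\<infinity>y. g x * w x y)"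
    using infsum_Sigma'_banach[of "\<lambda>x y. g x * w x y" UNIV "\<lambda>_. UNIV"] sp by simp
  also have "\<dots> = (\<Sum>\<^sub>\<infinity>x. g x * (\<Sum>\<^sub>\<infinity>y. w x y))"
    using assms(1) by (simp add: infsum_cmult_right)
  also have "\<dots> \<le> (\<Sum>\<^sub>\<infinity>x. c x)"
    by (rule infsum_mono[OF s assms(5,4)])
  finally show "(\<Sum>\<^sub>\<infinity>(x, y). g x * w x y) \<le> (\<Sum>\<^sub>\<infinity>x. c x)" .
qed

lemma summable_on_swap_pair:
  fixes h :: "'a \<Rightarrow> 'a \<Rightarrow> real"
  assumes "(\<lambda>(x, y). h x y) summable_on UNIV"
  shows "(\<lambda>(x, y). h y x) summable_on UNIV"
    and "(\<Sum>\<^sub>\<infinity>(x, y). h y x) = (\<Sum>\<^sub>\<infinity>(x, y). h x y)"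
proof -
  have "((\<lambda>(x, y). h x y) has_sum (\<Sum>\<^sub>\<infinity>(x, y). h x y)) (UNIV \<times> UNIV)"
    using assms by simp
  then have "((\<lambda>(x, y). h y x) has_sum (\<Sum>\<^sub>\<infinity>(x, y). h x y)) UNIV"
    by (subst (asm) has_sum_swap) (simp add: case_prod_unfold)
  then show "(\<lambda>(x, y). h y x) summable_on UNIV"
    "(\<Sum>\<^sub>\<infinity>(x, y). h y x) = (\<Sum>\<^sub>\<infinity>(x, y). h x y)"
    by (auto simp: summable_on_def dest: infsumI)
qed

text \<open>
  A finite set carrying all but \<open>e\<close> of the sum lies below some level of \<open>\<rho>\<close>.  The sublevel sets
  themselves may be infinite.
\<close>
lemma tail_tendsto_0:
  fixes g \<rho> :: "'a \<Rightarrow> real"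
  assumes g: "g summable_on UNIV" "\<And>x. 0 \<le> g x" and "e > 0"
  shows "\<exists>r0. \<forall>r\<ge>r0. (\<Sum>\<^sub>\<infinity>x. if r \<le> \<rho> x then g x else 0) \<le> e"
proof -
  obtain F where F: "finite F" "dist (sum g F) (infsum g UNIV) \<le> e"
    using infsum_finite_approximation[OF g(1) assms(3)] by auto
  (* Inserting 0 covers the case that F is empty. *)
  define r0 where "r0 = Max (insert 0 (\<rho> ` F)) + 1"
  have r0: "\<rho> x < r0" if "x \<in> F" for x
  proof -
    have "\<rho> x \<le> Max (insert 0 (\<rho> ` F))" using F(1) that by (intro Max_ge) auto
    then show ?thesis by (simp add: r0_def)
  qed
  have "(\<Sum>\<^sub>\<infinity>x. if r \<le> \<rho> x then g x else 0) \<le> e" if "r \<ge> r0" for r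
  proof -
    have s: "(\<lambda>x. if r \<le> \<rho> x then g x else 0) summable_on UNIV"
      by (rule summable_on_comparison_test[OF g(1)]) (use g in auto)
    have "(\<Sum>\<^sub>\<infinity>x. if r \<le> \<rho> x then g x else 0) \<le> (\<Sum>\<^sub>\<infinity>x\<in>UNIV - F. g x)"
      by (rule infsum_mono_neutral[OF s summable_on_cofin_subset[OF g(1) F(1)]])
         (use r0 that g in \<open>fastforce+\<close>)
    also have "\<dots> = infsum g UNIV - sum g F"
      using F(1) g(1) by (subst infsum_Diff) auto
    also have "\<dots> \<le> e" using F(2) by (simp add: dist_real_def)
    finally show ?thesis .
  qed
  then show ?thesis by blast
qed

section \<open>The Liouville theorem for subharmonic functions\<close>

locale compatible_intrinsic_graph = weighted_graph m \<mu> for m :: "'v::countable \<Rightarrow> real" and \<mu> +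
  fixes \<rho> :: "'v \<Rightarrow> 'v \<Rightarrow> real" and x\<^sub>0 :: 'v
  assumes pseudo: "pseudo_metric \<rho>"
    and intrinsic: "intrinsic m \<mu> \<rho>"
    and compatible: "compatible m \<mu> x\<^sub>0 \<rho>"
begin

text \<open>The point masses of the measure \<open>m \<rho>\<^sub>1\<^sup>-\<^sup>2\<close> that defines the \<open>L\<^sup>p\<close> condition.\<close>
abbreviation "wt x \<equiv> m x / (rho1 \<rho> x\<^sub>0 x)\<^sup>2"

lemma \<rho>_nonneg: "0 \<le> \<rho> x y" and \<rho>_triangle: "\<bar>\<rho> x x\<^sub>0 - \<rho> y x\<^sub>0\<bar> \<le> \<rho> x y"
proof -
  show "0 \<le> \<rho> x y" using pseudo by (simp add: pseudo_metric_def)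
  have "\<rho> x x\<^sub>0 \<le> \<rho> x y + \<rho> y x\<^sub>0" "\<rho> y x\<^sub>0 \<le> \<rho> y x + \<rho> x x\<^sub>0" "\<rho> y x = \<rho> x y"
    using pseudo unfolding pseudo_metric_def by blast+
  then show "\<bar>\<rho> x x\<^sub>0 - \<rho> y x\<^sub>0\<bar> \<le> \<rho> x y" by linarith
qed

lemma jump_bound: "\<exists>s\<ge>0. \<forall>x y. \<mu> x y \<noteq> 0 \<longrightarrow> \<rho> x y \<le> s"
proof -
  have fin: "jump_size \<mu> \<rho> < \<infinity>" using compatible by (simp add: compatible_def)
  have "\<rho> x y \<le> enn2real (jump_size \<mu> \<rho>)" if "\<mu> x y \<noteq> 0" for x y
  proof -
    have "adjacent \<mu> x y" using that \<mu>_nonneg[of x y] by (simp add: adjacent_def)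
    then have "ennreal (\<rho> x y) \<le> jump_size \<mu> \<rho>"
      unfolding jump_size_def by (intro Sup_upper) blast
    then have "enn2real (ennreal (\<rho> x y)) \<le> enn2real (jump_size \<mu> \<rho>)"
      using fin by (intro enn2real_mono) auto
    then show ?thesis using \<rho>_nonneg by simp
  qed
  then show ?thesis by (intro exI[of _ "enn2real (jump_size \<mu> \<rho>)"]) auto
qed

lemma degree_bound: "\<exists>D\<ge>0. \<forall>x. \<rho> x x\<^sub>0 \<le> r \<longrightarrow> (\<Sum>\<^sub>\<infinity>y. \<mu> x y) \<le> D * m x"
proof (cases "r \<ge> 0")
  case True
  then obtain D where D: "\<And>x. \<rho> x x\<^sub>0 \<le> r \<Longrightarrow> \<bar>weighted_degree m \<mu> x\<bar> \<le> D"
    using compatible by (auto simp: compatible_def bounded_iff)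
  have "(\<Sum>\<^sub>\<infinity>y. \<mu> x y) \<le> max 0 D * m x" if "\<rho> x x\<^sub>0 \<le> r" for x
  proof -
    have "(\<Sum>\<^sub>\<infinity>y. \<mu> x y) = weighted_degree m \<mu> x * m x"
      using m_pos[of x] by (simp add: weighted_degree_def)
    also have "\<dots> \<le> max 0 D * m x"
      using D[OF that] m_pos[of x] by (intro mult_right_mono) auto
    finally show ?thesis .
  qed
  then show ?thesis by (intro exI[of _ "max 0 D"]) auto
next
  case False
  then show ?thesis using \<rho>_nonneg[of _ x\<^sub>0] by (intro exI[of _ 0]) (auto dest: order_trans)
qed

definition cutoff :: "real \<Rightarrow> 'v \<Rightarrow> real" where
  "cutoff R x = max 0 (min 1 (2 - \<rho> x x\<^sub>0 / R))"

lemma cutoff_range: "0 \<le> cutoff R x" "cutoff R x \<le> 1" by (simp_all add: cutoff_def)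

lemma cutoff_eq_1: "cutoff R x = 1" if "R > 0" "\<rho> x x\<^sub>0 \<le> R"
  using that by (simp add: cutoff_def)

lemma cutoff_eq_0: "cutoff R x = 0" if "R > 0" "\<rho> x x\<^sub>0 \<ge> 2 * R"
  using that by (simp add: cutoff_def pos_le_divide_eq)

lemma cutoff_Lipschitz: "(cutoff R x - cutoff R y)\<^sup>2 \<le> (\<rho> x y)\<^sup>2 / R\<^sup>2" if "R > 0"
proof -
  have "\<bar>cutoff R x - cutoff R y\<bar> \<le> \<bar>\<rho> x x\<^sub>0 / R - \<rho> y x\<^sub>0 / R\<bar>" by (simp add: cutoff_def)
  also have "\<dots> = \<bar>\<rho> x x\<^sub>0 - \<rho> y x\<^sub>0\<bar> / R" using that by (simp flip: diff_divide_distrib)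
  also have "\<dots> \<le> \<rho> x y / R" using that \<rho>_triangle[of x y] by (simp add: divide_right_mono)
  finally have "\<bar>cutoff R x - cutoff R y\<bar>\<^sup>2 \<le> (\<rho> x y / R)\<^sup>2" by (rule power_mono) simp
  then show ?thesis by (simp add: power_divide)
qed

text \<open>
  The cutoff function is locally constant except between the radii \<open>R\<close> and \<open>2 * R\<close>, and edges have
  length at most \<open>s\<close>; so the sum vanishes unless \<open>R - s \<le> \<rho> x x\<^sub>0 \<le> 2 * R + s\<close>.  In that annulus the
  intrinsic condition bounds it by \<open>m x / R\<^sup>2\<close>, and \<open>rho1\<close> is at most \<open>3 * R\<close>, whence the 9.
\<close>
lemma cutoff_energy_le:
  assumes s: "\<And>x y. \<mu> x y \<noteq> 0 \<Longrightarrow> \<rho> x y \<le> s" and R: "1 \<le> R" "s \<le> R"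
  shows "(\<lambda>y. \<mu> x y * (cutoff R x - cutoff R y)\<^sup>2) summable_on UNIV"
    and "(\<Sum>\<^sub>\<infinity>y. \<mu> x y * (cutoff R x - cutoff R y)\<^sup>2) \<le> (if R - s \<le> \<rho> x x\<^sub>0 then 9 * wt x else 0)"
proof -
  let ?h = "\<lambda>y. \<mu> x y * (cutoff R x - cutoff R y)\<^sup>2"
  have int: "(\<lambda>y. \<mu> x y * (\<rho> x y)\<^sup>2) summable_on UNIV" "(\<Sum>\<^sub>\<infinity>y. \<mu> x y * (\<rho> x y)\<^sup>2) \<le> m x"
    using intrinsic by (auto simp: intrinsic_def)
  have le: "?h y \<le> 1 / R\<^sup>2 * (\<mu> x y * (\<rho> x y)\<^sup>2)" for y
    using mult_left_mono[OF cutoff_Lipschitz[of R x y] \<mu>_nonneg[of x y]] R by simp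
  have cs: "(\<lambda>y. 1 / R\<^sup>2 * (\<mu> x y * (\<rho> x y)\<^sup>2)) summable_on UNIV"
    by (rule summable_on_cmult_right[OF int(1)])
  show sum: "?h summable_on UNIV"
    by (rule summable_on_comparison_test[OF cs le]) (simp add: \<mu>_nonneg)
  have near: "\<bar>\<rho> x x\<^sub>0 - \<rho> y x\<^sub>0\<bar> \<le> s" if "\<mu> x y \<noteq> 0" for y
    using \<rho>_triangle[of x y] s[OF that] by linarith
  have wt0: "wt x \<ge> 0" using m_pos[of x] by (simp add: less_imp_le)
  consider "\<rho> x x\<^sub>0 < R - s" | "\<rho> x x\<^sub>0 > 2 * R + s" | "R - s \<le> \<rho> x x\<^sub>0" "\<rho> x x\<^sub>0 \<le> 2 * R + s" by linarith
  then show "(\<Sum>\<^sub>\<infinity>y. ?h y) \<le> (if R - s \<le> \<rho> x x\<^sub>0 then 9 * wt x else 0)"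
  proof cases
    case 1
    have z: "?h y = 0" for y
    proof (cases "\<mu> x y = 0")
      case False
      then have "\<rho> x x\<^sub>0 \<le> R" "\<rho> y x\<^sub>0 \<le> R"
        using near[of y] 1 s[of x y] \<rho>_nonneg[of x y] by (auto simp: abs_le_iff)
      then show ?thesis using R by (simp add: cutoff_eq_1)
    qed simp
    show ?thesis unfolding z using wt0 by simp
  next
    case 2
    have z: "?h y = 0" for y
    proof (cases "\<mu> x y = 0")
      case False
      then have "\<rho> x x\<^sub>0 \<ge> 2 * R" "\<rho> y x\<^sub>0 \<ge> 2 * R"
        using near[of y] 2 s[of x y] \<rho>_nonneg[of x y] by (auto simp: abs_le_iff)
      then show ?thesis using R by (simp add: cutoff_eq_0)
    qed simp
    show ?thesis unfolding z using wt0 by simp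
  next
    case 3
    have "(\<Sum>\<^sub>\<infinity>y. ?h y) \<le> (\<Sum>\<^sub>\<infinity>y. 1 / R\<^sup>2 * (\<mu> x y * (\<rho> x y)\<^sup>2))"
      by (rule infsum_mono[OF sum cs le])
    also have "\<dots> \<le> 1 / R\<^sup>2 * m x"
      unfolding infsum_cmult_right[OF int(1)] by (rule mult_left_mono[OF int(2)]) simp
    also have "\<dots> \<le> 9 * wt x"
    proof -
      have r: "1 \<le> rho1 \<rho> x\<^sub>0 x" "rho1 \<rho> x\<^sub>0 x \<le> 3 * R" using 3 R by (auto simp: rho1_def)
      then have "(rho1 \<rho> x\<^sub>0 x)\<^sup>2 \<le> (3 * R)\<^sup>2" by (intro power_mono) auto
      then have "(rho1 \<rho> x\<^sub>0 x)\<^sup>2 \<le> 9 * R\<^sup>2" by (simp add: power_mult_distrib)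
      then have "m x * (rho1 \<rho> x\<^sub>0 x)\<^sup>2 \<le> m x * (9 * R\<^sup>2)" by (rule mult_left_mono) (simp add: m_pos less_imp_le)
      then show ?thesis using r(1) R by (simp add: field_simps)
    qed
    finally show ?thesis using 3 by simp
  qed
qed

text \<open>
  On a ball the weight \<open>wt\<close> is comparable to \<open>m\<close>, and the degree bound controls the sum of \<open>\<mu> x\<close> by
  \<open>m x\<close>.  This is where boundedness of the weighted degree on balls is used.
\<close>
lemma ball_sum:
  assumes g: "\<And>x. 0 \<le> g x" "(\<lambda>x. g x * wt x) summable_on UNIV"
  shows "(\<lambda>(x, y). (if \<rho> x x\<^sub>0 \<le> r then g x else 0) * \<mu> x y) summable_on UNIV"
proof -
  obtain D where D: "D \<ge> 0" "\<And>x. \<rho> x x\<^sub>0 \<le> r \<Longrightarrow> (\<Sum>\<^sub>\<infinity>y. \<mu> x y) \<le> D * m x"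
    using degree_bound by blast
  define r' where "r' = max 1 r"
  have wt0: "wt x \<ge> 0" for x using m_pos[of x] by (simp add: less_imp_le)
  show ?thesis
  proof (rule weighted_pair_sum(1))
    show "(\<lambda>x. D * r'\<^sup>2 * (g x * wt x)) summable_on UNIV"
      by (rule summable_on_cmult_right[OF g(2)])
    fix x
    show "(if \<rho> x x\<^sub>0 \<le> r then g x else 0) * (\<Sum>\<^sub>\<infinity>y. \<mu> x y) \<le> D * r'\<^sup>2 * (g x * wt x)"
    proof (cases "\<rho> x x\<^sub>0 \<le> r")
      case True
      have r: "1 \<le> rho1 \<rho> x\<^sub>0 x" "rho1 \<rho> x\<^sub>0 x \<le> r'" using True by (auto simp: rho1_def r'_def)
      then have "(rho1 \<rho> x\<^sub>0 x)\<^sup>2 * wt x \<le> r'\<^sup>2 * wt x" by (intro mult_right_mono power_mono wt0) auto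
      then have "m x \<le> r'\<^sup>2 * wt x" using r(1) by simp
      then have "D * m x \<le> D * (r'\<^sup>2 * wt x)" by (rule mult_left_mono[OF _ D(1)])
      with D(2)[OF True] have "(\<Sum>\<^sub>\<infinity>y. \<mu> x y) \<le> D * (r'\<^sup>2 * wt x)" by linarith
      then have "g x * (\<Sum>\<^sub>\<infinity>y. \<mu> x y) \<le> g x * (D * (r'\<^sup>2 * wt x))" by (rule mult_left_mono[OF _ g(1)])
      then show ?thesis using True by (simp add: algebra_simps)
    next
      case False
      have "0 \<le> D * r'\<^sup>2 * (g x * wt x)" by (intro mult_nonneg_nonneg D(1) g(1) wt0) simp
      then show ?thesis using False by simp
    qed
  qed (use g \<mu>_nonneg \<mu>_summable in auto)
qed

text \<open>
  Here \<open>H\<close> is the summand of the subharmonic inequality tested with \<open>f powr (p - 1)\<close> times the squared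
  cutoff function, \<open>E\<close> the energy to be estimated and \<open>K\<close> the error from differences of the cutoff
  function.  Since \<open>E\<close> is bounded by \<open>C * (K x y + K y x) - (H x y + H y x)\<close> on each pair, since the sum
  of \<open>H\<close> is nonnegative, and since swapping \<open>x\<close> and \<open>y\<close> leaves sums over all pairs unchanged, a single
  summand of the nonnegative \<open>E\<close> is at most \<open>2 * C\<close> times the sum of \<open>K\<close>.
\<close>
lemma Caccioppoli:
  assumes sub: "subharmonic f" and f: "\<And>x. 0 \<le> f x" and p: "1 < p"
    and Lp: "(\<lambda>x. f x powr p * wt x) summable_on UNIV"
    and s: "\<And>x y. \<mu> x y \<noteq> 0 \<Longrightarrow> \<rho> x y \<le> s" and R: "1 \<le> R" "s \<le> R"
    and ab: "\<rho> a x\<^sub>0 \<le> R" "\<rho> b x\<^sub>0 \<le> R"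
  shows "\<mu> a b * ((f a - f b) * (f a powr (p - 1) - f b powr (p - 1)))
    \<le> 72 / min 1 (p - 1) * (\<Sum>\<^sub>\<infinity>x. if R - s \<le> \<rho> x x\<^sub>0 then f x powr p * wt x else 0)"
proof -
  define q where "q = p - 1"
  have q: "q > 0" "p = q + 1" using p by (simp_all add: q_def)
  let ?h = "cutoff R"
  define C where "C = 2 / min 1 q"
  have C: "C \<ge> 0" using q by (simp add: C_def)
  define L where "L = (\<Sum>\<^sub>\<infinity>x. if R - s \<le> \<rho> x x\<^sub>0 then f x powr p * wt x else 0)"
  define T where "T x y = (if \<rho> x x\<^sub>0 \<le> 2 * R + s then f x powr p else 0) * \<mu> x y" for x y
  define H where "H x y = \<mu> x y * (f y - f x) * (f x powr q * (?h x)\<^sup>2)" for x y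
  define K where "K x y = f x powr p * (\<mu> x y * (?h x - ?h y)\<^sup>2)" for x y
  define E where "E x y = \<mu> x y * ((f x - f y) * (f x powr q - f y powr q) * ((?h x)\<^sup>2 + (?h y)\<^sup>2) / 4)" for x y

  have T: "(\<lambda>(x, y). T x y) summable_on UNIV"
    unfolding T_def by (rule ball_sum[OF _ Lp]) simp
  have T0: "T x y \<ge> 0" for x y by (simp add: T_def \<mu>_nonneg)

  (* H lives on pairs with x in the ball of radius 2 R; then y is in the ball of radius 2 R + s,
     so that both f x powr p and f y powr p are seen by T. *)
  have H_le: "\<bar>H x y\<bar> \<le> T x y + T y x" for x y
  proof (cases "\<mu> x y = 0 \<or> ?h x = 0")
    case True
    then show ?thesis using T0[of x y] T0[of y x] by (auto simp: H_def)
  next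
    case False
    then have near: "\<rho> x x\<^sub>0 \<le> 2 * R" "\<rho> x y \<le> s" "\<rho> y x\<^sub>0 \<le> \<rho> x x\<^sub>0 + \<rho> x y"
      using cutoff_eq_0[of R x] R s[of x y] \<rho>_triangle[of x y] by (force simp: abs_le_iff)+
    then have "\<rho> x x\<^sub>0 \<le> 2 * R + s" "\<rho> y x\<^sub>0 \<le> 2 * R + s" using \<rho>_nonneg[of x y] by linarith+
    then have TT: "T x y = f x powr p * \<mu> x y" "T y x = f y powr p * \<mu> x y"
      by (simp_all add: T_def \<mu>_sym[of y x])
    define M where "M = max (f x) (f y)"
    have M: "f x \<le> M" "f y \<le> M" "M \<ge> 0" using f[of x] by (auto simp: M_def)
    have "\<bar>f y - f x\<bar> * (f x powr q * (?h x)\<^sup>2) \<le> M * (M powr q * 1)"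
      using M f[of x] f[of y] cutoff_range[of R x] q
      by (intro mult_mono powr_mono2 power_le_one) auto
    also have "\<dots> = M powr p" using M(3) q by (cases "M = 0") (simp_all add: powr_add)
    also have "\<dots> \<le> f x powr p + f y powr p" by (simp add: M_def max_def)
    finally have "\<mu> x y * (\<bar>f y - f x\<bar> * (f x powr q * (?h x)\<^sup>2)) \<le> \<mu> x y * (f x powr p + f y powr p)"
      by (rule mult_left_mono) (rule \<mu>_nonneg)
    moreover have "\<bar>H x y\<bar> = \<mu> x y * (\<bar>f y - f x\<bar> * (f x powr q * (?h x)\<^sup>2))"
      using \<mu>_nonneg[of x y] by (simp add: H_def abs_mult)
    ultimately show ?thesis by (simp add: TT algebra_simps)
  qed
  have "(\<lambda>z. (\<lambda>(x, y). T x y) z + (\<lambda>(x, y). T y x) z) summable_on UNIV"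
    by (intro summable_on_add T summable_on_swap_pair(1)[OF T])
  then have "(\<lambda>z. \<bar>(\<lambda>(x, y). H x y) z\<bar>) summable_on UNIV"
    by (rule summable_on_comparison_test) (use H_le in auto)
  then have H: "(\<lambda>(x, y). H x y) summable_on UNIV"
    by (subst summable_on_iff_abs_summable_on_real) (simp only: real_norm_def)
  have "(\<Sum>\<^sub>\<infinity>(x, y). H x y) = (\<Sum>\<^sub>\<infinity>x. \<Sum>\<^sub>\<infinity>y. H x y)"
    using infsum_Sigma'_banach[of H UNIV "\<lambda>_. UNIV"] H by simp
  also have "\<dots> \<ge> 0"
  proof (rule infsum_nonneg)
    fix x
    have 1: "(\<lambda>y. \<mu> x y * f y) summable_on UNIV" "f x * (\<Sum>\<^sub>\<infinity>y. \<mu> x y) \<le> (\<Sum>\<^sub>\<infinity>y. \<mu> x y * f y)"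
      using sub by (auto simp: subharmonic_def)
    have 2: "(\<lambda>y. f x * \<mu> x y) summable_on UNIV" by (rule summable_on_cmult_right[OF \<mu>_summable])
    have 3: "(\<lambda>y. \<mu> x y * f y - f x * \<mu> x y) summable_on UNIV" by (rule summable_on_diff(1)[OF 1(1) 2])
    have "H x y = (f x powr q * (?h x)\<^sup>2) * (\<mu> x y * f y - f x * \<mu> x y)" for y
      by (simp add: H_def algebra_simps)
    then have "(\<Sum>\<^sub>\<infinity>y. H x y) = (f x powr q * (?h x)\<^sup>2) * (\<Sum>\<^sub>\<infinity>y. \<mu> x y * f y - f x * \<mu> x y)"
      by (simp add: infsum_cmult_right[OF 3])
    also have "(\<Sum>\<^sub>\<infinity>y. \<mu> x y * f y - f x * \<mu> x y) = (\<Sum>\<^sub>\<infinity>y. \<mu> x y * f y) - f x * (\<Sum>\<^sub>\<infinity>y. \<mu> x y)"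
      using summable_on_diff(2)[OF 1(1) 2] infsum_cmult_right[OF \<mu>_summable, of "f x" x] by simp
    finally show "0 \<le> (\<Sum>\<^sub>\<infinity>y. H x y)" using 1(2) by simp
  qed
  finally have H_nonneg: "(\<Sum>\<^sub>\<infinity>(x, y). H x y) \<ge> 0" .

  have K: "(\<lambda>(x, y). K x y) summable_on UNIV" "(\<Sum>\<^sub>\<infinity>(x, y). K x y) \<le> 9 * L"
  proof -
    have sL: "(\<lambda>x. if R - s \<le> \<rho> x x\<^sub>0 then f x powr p * wt x else 0) summable_on UNIV"
      by (rule summable_on_comparison_test[OF Lp]) (use m_pos in \<open>auto simp: less_imp_le\<close>)
    have le: "f x powr p * (\<Sum>\<^sub>\<infinity>y. \<mu> x y * (?h x - ?h y)\<^sup>2)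
        \<le> 9 * (if R - s \<le> \<rho> x x\<^sub>0 then f x powr p * wt x else 0)" for x
      using mult_left_mono[OF cutoff_energy_le(2)[OF s R, of x], of "f x powr p"]
      by (simp add: mult.left_commute[of "f x powr p" 9] split: if_splits)
    note * = cutoff_energy_le(1)[OF s R] _ _ le summable_on_cmult_right[OF sL]
    show "(\<lambda>(x, y). K x y) summable_on UNIV"
      unfolding K_def by (rule weighted_pair_sum(1)[OF *]) (simp_all add: \<mu>_nonneg)
    have "(\<Sum>\<^sub>\<infinity>(x, y). K x y) \<le> (\<Sum>\<^sub>\<infinity>x. 9 * (if R - s \<le> \<rho> x x\<^sub>0 then f x powr p * wt x else 0))"
      unfolding K_def by (rule weighted_pair_sum(2)[OF *]) (simp_all add: \<mu>_nonneg)
    then show "(\<Sum>\<^sub>\<infinity>(x, y). K x y) \<le> 9 * L"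
      unfolding L_def using infsum_cmult_right[OF sL, of 9] by simp
  qed

  define S where "S x y = C * (K x y + K y x) - (H x y + H y x)" for x y
  have E_le: "E x y \<le> S x y" for x y
  proof -
    have "\<mu> x y * ((f x - f y) * (f x powr q - f y powr q) * ((?h x)\<^sup>2 + (?h y)\<^sup>2) / 4
        - C * (f x powr (q + 1) + f y powr (q + 1)) * (?h x - ?h y)\<^sup>2)
      \<le> \<mu> x y * ((f x - f y) * (f x powr q * (?h x)\<^sup>2 - f y powr q * (?h y)\<^sup>2))"
      unfolding C_def by (rule mult_left_mono[OF pointwise_Caccioppoli[OF f f q(1)] \<mu>_nonneg])
    moreover have "- (H x y + H y x) = \<mu> x y * ((f x - f y) * (f x powr q * (?h x)\<^sup>2 - f y powr q * (?h y)\<^sup>2))"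
      by (simp add: H_def \<mu>_sym[of y x] algebra_simps)
    moreover have "K x y + K y x = \<mu> x y * ((f x powr (q + 1) + f y powr (q + 1)) * (?h x - ?h y)\<^sup>2)"
      by (simp add: K_def \<mu>_sym[of y x] power2_commute[of "?h y"] q(2) algebra_simps)
    ultimately show ?thesis
      unfolding S_def E_def by (simp add: algebra_simps)
  qed
  have E0: "E x y \<ge> 0" for x y
  proof -
    have mono: "(f x - f y) * (f x powr q - f y powr q) \<ge> 0"
    proof (cases "f x \<le> f y")
      case True
      then show ?thesis using powr_mono2[of q "f x" "f y"] f[of x] q by (intro mult_nonpos_nonpos) auto
    next
      case False
      then show ?thesis using powr_mono2[of q "f y" "f x"] f[of y] q by (intro mult_nonneg_nonneg) auto
    qed
    then show ?thesis
      unfolding E_def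
      by (intro mult_nonneg_nonneg[OF \<mu>_nonneg] divide_nonneg_nonneg mult_nonneg_nonneg[OF mono]) auto
  qed
  have K2: "(\<lambda>z. (\<lambda>(x, y). K x y) z + (\<lambda>(x, y). K y x) z) summable_on UNIV"
    "(\<Sum>\<^sub>\<infinity>z. (\<lambda>(x, y). K x y) z + (\<lambda>(x, y). K y x) z) \<le> 18 * L"
    using K summable_on_swap_pair[OF K(1)]
    by (auto intro: summable_on_add simp: infsum_add)
  have H2: "(\<lambda>z. (\<lambda>(x, y). H x y) z + (\<lambda>(x, y). H y x) z) summable_on UNIV"
    "(\<Sum>\<^sub>\<infinity>z. (\<lambda>(x, y). H x y) z + (\<lambda>(x, y). H y x) z) \<ge> 0"
    using H H_nonneg summable_on_swap_pair[OF H]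
    by (auto intro: summable_on_add simp: infsum_add)
  have S_eq: "(\<lambda>(x, y). S x y) = (\<lambda>z. C * ((\<lambda>(x, y). K x y) z + (\<lambda>(x, y). K y x) z)
      - ((\<lambda>(x, y). H x y) z + (\<lambda>(x, y). H y x) z))"
    by (auto simp: S_def)
  have S: "(\<lambda>(x, y). S x y) summable_on UNIV"
    unfolding S_eq by (intro summable_on_diff(1) summable_on_cmult_right K2 H2)
  have "(\<Sum>\<^sub>\<infinity>(x, y). S x y) \<le> C * (18 * L)"
    unfolding S_eq summable_on_diff(2)[OF summable_on_cmult_right[OF K2(1)] H2(1)] infsum_cmult_right[OF K2(1)]
    using mult_left_mono[OF K2(2) C] H2(2) by linarith
  moreover have "S a b \<le> (\<Sum>\<^sub>\<infinity>(x, y). S x y)"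
    using finite_sum_le_infsum[OF S, of "{(a, b)}"] order_trans[OF E0 E_le] by auto
  ultimately have "E a b \<le> C * (18 * L)" using E_le[of a b] by linarith
  moreover have "E a b = \<mu> a b * ((f a - f b) * (f a powr q - f b powr q)) / 2"
    using ab R by (simp add: E_def cutoff_eq_1)
  ultimately show ?thesis
    unfolding L_def[symmetric] q_def[symmetric] by (simp add: C_def)
qed

text \<open>
  For an edge with different values of \<open>f\<close> the left-hand side of the Caccioppoli inequality is a fixed
  positive number, while the tail on its right-hand side tends to zero as \<open>R\<close> grows.
\<close>
theorem subharmonic_Lp_constant:
  assumes "connected_graph \<mu>" and sub: "subharmonic f" and f: "\<And>x. 0 \<le> f x" and p: "1 < p"
    and Lp: "(\<lambda>x. f x powr p * wt x) summable_on UNIV"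
  shows "f x = f y"
proof -
  obtain s where s: "s \<ge> 0" "\<And>x y. \<mu> x y \<noteq> 0 \<Longrightarrow> \<rho> x y \<le> s" using jump_bound by blast
  have edge: "f a = f b" if "adjacent \<mu> a b" for a b
  proof (rule ccontr)
    assume ne: "f a \<noteq> f b"
    define X where "X = \<mu> a b * ((f a - f b) * (f a powr (p - 1) - f b powr (p - 1)))"
    have "(f a - f b) * (f a powr (p - 1) - f b powr (p - 1)) > 0"
    proof (cases "f a < f b")
      case True
      then show ?thesis using powr_less_mono2[of "p - 1" "f a" "f b"] f[of a] p by (intro mult_neg_neg) auto
    next
      case False
      then show ?thesis using ne powr_less_mono2[of "p - 1" "f b" "f a"] f[of b] p by (intro mult_pos_pos) auto
    qed
    then have X: "X > 0" using that by (simp add: X_def adjacent_def)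
    define k where "k = 72 / min 1 (p - 1)"
    have k: "k > 0" using p by (simp add: k_def)
    obtain r0 where r0: "\<And>r. r \<ge> r0 \<Longrightarrow>
        (\<Sum>\<^sub>\<infinity>x. if r \<le> \<rho> x x\<^sub>0 then f x powr p * wt x else 0) \<le> X / (2 * k)"
      using tail_tendsto_0[OF Lp, of "X / (2 * k)" "\<lambda>x. \<rho> x x\<^sub>0"] m_pos X k
      by (auto simp: less_imp_le)
    define R where "R = Max {1, s, r0 + s, \<rho> a x\<^sub>0, \<rho> b x\<^sub>0}"
    have R: "1 \<le> R" "s \<le> R" "r0 \<le> R - s" "\<rho> a x\<^sub>0 \<le> R" "\<rho> b x\<^sub>0 \<le> R"
      by (simp_all add: R_def le_diff_eq)
    have "X \<le> k * (\<Sum>\<^sub>\<infinity>x. if R - s \<le> \<rho> x x\<^sub>0 then f x powr p * wt x else 0)"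
      unfolding X_def k_def by (rule Caccioppoli[OF sub f p Lp s(2) R(1,2,4,5)])
    also have "\<dots> \<le> k * (X / (2 * k))" using k r0[OF R(3)] by (intro mult_left_mono) auto
    also have "\<dots> = X / 2" using k by simp
    finally show False using X by simp
  qed
  have "(adjacent \<mu>)\<^sup>*\<^sup>* x y" using assms(1) by (simp add: connected_graph_def)
  then show ?thesis by (induction rule: rtranclp_induct) (auto dest: edge)
qed

end

section \<open>Harmonic maps at weighted p-integrable distance from a point\<close>

theorem theorem1p11:
  fixes m :: "'v::countable \<Rightarrow> real" and \<mu> :: "'v \<Rightarrow> 'v \<Rightarrow> real"
    and \<rho> :: "'v \<Rightarrow> 'v \<Rightarrow> real" and x\<^sub>0 :: 'v
    and u :: "'v \<Rightarrow> 'y::hadamard_space" and y :: 'y and p :: real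
  assumes "weighted_graph m \<mu>"
    and "connected_graph \<mu>"
    and "pseudo_metric \<rho>"
    and "intrinsic m \<mu> \<rho>"
    and "compatible m \<mu> x\<^sub>0 \<rho>"
    and "harmonic_map \<mu> u"
    and "1 < p"
    and "in_Lp p (\<lambda>x. m x / (rho1 \<rho> x\<^sub>0 x)\<^sup>2) (\<lambda>x. dist (u x) y)"
  shows "bounded (range u) \<and>
    (\<not> (\<lambda>x. m x / (rho1 \<rho> x\<^sub>0 x)\<^sup>2) summable_on UNIV \<or> y \<in> range u
      \<longrightarrow> u constant_on UNIV)"
proof -
  interpret compatible_intrinsic_graph m \<mu> \<rho> x\<^sub>0
    using assms(1,3,4,5)
    by (simp add: compatible_intrinsic_graph_def compatible_intrinsic_graph_axioms_def)
  have Lp: "(\<lambda>x. dist (u x) y powr p * wt x) summable_on UNIV"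
    using assms(8) by (simp add: in_Lp_def)
  define c where "c = dist (u x\<^sub>0) y"
  have c: "dist (u x) y = c" for x
    unfolding c_def
    by (rule subharmonic_Lp_constant[OF assms(2) subharmonic_dist_harmonic[OF assms(6)] _ assms(7) Lp]) simp
  have "range u \<subseteq> cball y c" using c by (auto simp: dist_commute)
  then have "bounded (range u)" using bounded_cball bounded_subset by blast
  moreover have "u constant_on UNIV" if "\<not> wt summable_on UNIV \<or> y \<in> range u"
  proof -
    have "c = 0"
      using that
    proof
      assume inf: "\<not> wt summable_on UNIV"
      show "c = 0"
      proof (rule ccontr)
        assume "c \<noteq> 0"
        then have "c powr p \<noteq> 0" by simp
        moreover have "(\<lambda>x. c powr p * wt x) summable_on UNIV" using Lp by (simp only: c)
        ultimately show False using inf summable_on_cmult_right'[of "c powr p" wt UNIV] by blast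
      qed
    next
      assume "y \<in> range u"
      then show "c = 0" using c by force
    qed
    then have "u x = y" for x using c[of x] by simp
    then show ?thesis by (auto simp: constant_on_def)
  qed
  ultimately show ?thesis by blast
qed

end
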